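(* The projective plane cubic curve $\mathcal{E}$ over $\mathbb{Q}$ defined in $\mathbb{P}^2$ with homogeneous coordinates $(a:b:c)$ by $$q(a,b,c) = -c^3 - c^2(a+b) + c(a^2+ab+b^2) + (a^3+a^2b+ab^2+b^3)=0$$ is an elliptic curve.
   Context: An elliptic curve here means a smooth projective plane cubic curve having a rational point (which may be chosen as the origin); the curve $\mathcal{E}$ contains, for example, the rational point $(1:-1:0)$. Smoothness is understood geometrically, i.e. over an algebraic closure of $\mathbb{Q}$ (equivalently over $\mathbb{C}$). *)

theory Defs
  imports
    "HOL-Library.Poly_Mapping"
    "HOL-Analysis.Cartesian_Space"
    "HOL-Algebra.Algebraic_Closure_Type"
begin

text \<open>
  Polynomials over \<open>'k\<close> in variables indexed by a finite type \<open>'n\<close>: finitely supported maps from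
  monomials (exponent vectors) to coefficients, with the convolution product of
  \<^theory>\<open>HOL-Library.Poly_Mapping\<close>.
\<close>

type_synonym ('n, 'k) mpol = "('n \<Rightarrow>\<^sub>0 nat) \<Rightarrow>\<^sub>0 'k"

definition Var :: "'n \<Rightarrow> ('n, 'k::comm_ring_1) mpol" where
  "Var i = Poly_Mapping.single (Poly_Mapping.single i 1) 1"

definition mpol_eval :: "('n::finite, 'k::comm_ring_1) mpol \<Rightarrow> 'k ^ 'n \<Rightarrow> 'k" where
  "mpol_eval f x =
     (\<Sum>m\<in>Poly_Mapping.keys f. Poly_Mapping.lookup f m * (\<Prod>i\<in>UNIV. (x $ i) ^ Poly_Mapping.lookup m i))"

text \<open>
  Formal partial derivative. The truncated subtraction of exponents is harmless: if the
  \<open>i\<close>-th exponent is 0, the coefficient of that term is 0.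
\<close>

definition mpol_deriv :: "'n \<Rightarrow> ('n, 'k::comm_ring_1) mpol \<Rightarrow> ('n, 'k) mpol" where
  "mpol_deriv i f =
     (\<Sum>m\<in>Poly_Mapping.keys f.
        Poly_Mapping.single (m - Poly_Mapping.single i 1)
          (of_nat (Poly_Mapping.lookup m i) * Poly_Mapping.lookup f m))"

definition homogeneous :: "nat \<Rightarrow> ('n::finite, 'k::comm_ring_1) mpol \<Rightarrow> bool" where
  "homogeneous d f \<longleftrightarrow>
     (\<forall>m\<in>Poly_Mapping.keys f. (\<Sum>i\<in>UNIV. Poly_Mapping.lookup m i) = d)"

text \<open>A point of projective space is the set of all its homogeneous coordinate vectors.\<close>

definition proj_point :: "'k::field ^ 'n \<Rightarrow> ('k ^ 'n) set" where
  "proj_point v = {t *s v | t. t \<noteq> 0}"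

definition proj_space :: "('k::field ^ 'n) set set" where
  "proj_space = {proj_point v | v. v \<noteq> 0}"

text \<open>
  For homogeneous \<open>f\<close>, vanishing does not depend on the choice of homogeneous coordinates.
\<close>

definition proj_zeros :: "('n::finite, 'k::field) mpol \<Rightarrow> ('k ^ 'n) set set" where
  "proj_zeros f = {P \<in> proj_space. \<forall>v\<in>P. mpol_eval f v = 0}"

text \<open>
  A projective plane cubic curve over \<open>'k\<close> is given by a nonzero form of degree 3 in three
  variables.
\<close>

definition plane_cubic :: "(3, 'k::field) mpol \<Rightarrow> bool" where
  "plane_cubic f \<longleftrightarrow> f \<noteq> 0 \<and> homogeneous 3 f"

definition singular_points :: "('n::finite, 'k::field) mpol \<Rightarrow> ('k ^ 'n) set set" where
  "singular_points f = {P \<in> proj_zeros f. \<forall>i. P \<in> proj_zeros (mpol_deriv i f)}"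

text \<open>Smoothness is geometric: no singular points over the algebraic closure.\<close>

definition smooth_hypersurface :: "('n::finite, 'k::field) mpol \<Rightarrow> bool" where
  "smooth_hypersurface f \<longleftrightarrow>
     singular_points (Poly_Mapping.map (to_ac :: 'k \<Rightarrow> 'k alg_closure) f) = {}"

definition elliptic_curve :: "(3, 'k::field) mpol \<Rightarrow> bool" where
  "elliptic_curve f \<longleftrightarrow> plane_cubic f \<and> smooth_hypersurface f \<and> proj_zeros f \<noteq> {}"

definition q :: "'r::comm_ring_1 \<Rightarrow> 'r \<Rightarrow> 'r \<Rightarrow> 'r" where
  "q a b c = - (c^3) - c^2 * (a + b) + c * (a^2 + a * b + b^2) + (a^3 + a^2 * b + a * b^2 + b^3)"

text \<open>
  The form defining the curve, with coordinates \<open>(a : b : c)\<close> indexed by the three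
  elements 1, 2, 3 of the index type \<open>3\<close> (where \<open>3 = 0\<close>).
\<close>

definition curve_E :: "(3, rat) mpol" where
  "curve_E = q (Var 1) (Var 2) (Var 3)"

end

theory Submission
  imports Defs
begin

text \<open>
  The difference of the partial derivatives of \<open>q\<close> with respect to \<open>a\<close> and \<open>b\<close> factors as
  \<open>(a - b) (c + 2 (a + b))\<close>. On the first line, the remaining conditions give \<open>a (13 c + 15 a) = 0\<close>,
  and \<open>13 c + 15 a = 0\<close> would imply \<open>204 a\<^sup>2 = 0\<close>; on the second one, they give \<open>18 (a + b)\<^sup>2 = 0\<close>.
  In characteristic 0, both lines are thus left with \<open>a = b = c = 0\<close> only.
\<close>

text \<open>Exponents outside \<open>keys f\<close> carry the coefficient 0. A common index set
  makes the sums for \<open>f\<close>, \<open>g\<close> and \<open>f + g\<close> comparable although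
  their supports differ.\<close>

lemma mpol_eval_superset:
  assumes "finite A" "Poly_Mapping.keys f \<subseteq> A"
  shows "mpol_eval f x =
    (\<Sum>m\<in>A. Poly_Mapping.lookup f m * (\<Prod>i\<in>UNIV. (x $ i) ^ Poly_Mapping.lookup m i))"
  unfolding mpol_eval_def
  by (rule sum.mono_neutral_left) (use assms in \<open>auto simp: in_keys_iff\<close>)

lemma mpol_eval_zero [simp]: "mpol_eval 0 x = 0"
  by (simp add: mpol_eval_def)

lemma mpol_eval_single [simp]:
  "mpol_eval (Poly_Mapping.single m c) x = c * (\<Prod>i\<in>UNIV. (x $ i) ^ Poly_Mapping.lookup m i)"
  by (subst mpol_eval_superset [of "{m}"]) auto

lemma mpol_eval_add [simp]: "mpol_eval (f + g) x = mpol_eval f x + mpol_eval g x"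
proof -
  let ?A = "Poly_Mapping.keys f \<union> Poly_Mapping.keys g"
  have "Poly_Mapping.keys (f + g) \<subseteq> ?A"
    by (rule keys_add)
  then show ?thesis
    by (simp add: mpol_eval_superset [of ?A] lookup_add algebra_simps sum.distrib)
qed

lemma mpol_deriv_superset:
  assumes "finite A" "Poly_Mapping.keys f \<subseteq> A"
  shows "mpol_deriv i f =
    (\<Sum>m\<in>A. Poly_Mapping.single (m - Poly_Mapping.single i 1)
      (of_nat (Poly_Mapping.lookup m i) * Poly_Mapping.lookup f m))"
  unfolding mpol_deriv_def
  by (rule sum.mono_neutral_left) (use assms in \<open>auto simp: in_keys_iff\<close>)

lemma mpol_deriv_single [simp]:
  "mpol_deriv i (Poly_Mapping.single m c) =
    Poly_Mapping.single (m - Poly_Mapping.single i 1) (of_nat (Poly_Mapping.lookup m i) * c)"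
  by (subst mpol_deriv_superset [of "{m}"]) auto

lemma mpol_deriv_add [simp]: "mpol_deriv i (f + g) = mpol_deriv i f + mpol_deriv i g"
proof -
  let ?A = "Poly_Mapping.keys f \<union> Poly_Mapping.keys g"
  have "Poly_Mapping.keys (f + g) \<subseteq> ?A"
    by (rule keys_add)
  then show ?thesis
    by (simp add: mpol_deriv_superset [of ?A] lookup_add algebra_simps single_add sum.distrib)
qed

text \<open>With \<open>h 0 = 0\<close>, mapping \<open>h\<close> acts on every coefficient,
  including those outside the support. This carries the expansion of the curve to the algebraic
  closure.\<close>

lemma map_add_poly_mapping:
  assumes "h 0 = 0" "\<And>a b. h (a + b) = h a + h b"
  shows "Poly_Mapping.map h (f + g) = Poly_Mapping.map h f + Poly_Mapping.map h g"
proof (rule poly_mapping_eqI)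
  have lookup_map: "Poly_Mapping.lookup (Poly_Mapping.map h p) k = h (Poly_Mapping.lookup p k)" for p k
    by (simp add: Poly_Mapping.map.rep_eq assms(1) when_def)
  show "Poly_Mapping.lookup (Poly_Mapping.map h (f + g)) k =
      Poly_Mapping.lookup (Poly_Mapping.map h f + Poly_Mapping.map h g) k" for k
    by (simp add: lookup_map lookup_add assms(2))
qed

lemma homogeneous_add: "homogeneous d f \<Longrightarrow> homogeneous d g \<Longrightarrow> homogeneous d (f + g)"
  using keys_add [of f g] unfolding homogeneous_def by blast

lemma homogeneous_single:
  "(\<Sum>i\<in>UNIV. Poly_Mapping.lookup m i) = d \<Longrightarrow> homogeneous d (Poly_Mapping.single m c)"
  by (simp add: homogeneous_def)

definition monom3 :: "nat \<Rightarrow> nat \<Rightarrow> nat \<Rightarrow> 'k \<Rightarrow> (3, 'k::comm_ring_1) mpol" where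
  "monom3 i j k = Poly_Mapping.single
     (Poly_Mapping.single 1 i + Poly_Mapping.single 2 j + Poly_Mapping.single 3 k)"

lemma prod_UNIV_3: "prod f (UNIV::3 set) = f 1 * f 2 * f 3"
  unfolding UNIV_3 by (simp add: ac_simps)

lemma mpol_eval_monom3 [simp]:
  "mpol_eval (monom3 i j k c) x = c * (x $ 1 ^ i * x $ 2 ^ j * x $ 3 ^ k)"
  by (simp add: monom3_def prod_UNIV_3 lookup_add lookup_single when_def)

lemma mpol_deriv_monom3 [simp]:
  "mpol_deriv 1 (monom3 i j k c) = monom3 (i - 1) j k (of_nat i * c)"
  "mpol_deriv 2 (monom3 i j k c) = monom3 i (j - 1) k (of_nat j * c)"
  "mpol_deriv 3 (monom3 i j k c) = monom3 i j (k - 1) (of_nat k * c)"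
proof -
  let ?m = "\<lambda>i j k. Poly_Mapping.single 1 i + Poly_Mapping.single 2 j + Poly_Mapping.single 3 k
    :: 3 \<Rightarrow>\<^sub>0 nat"
  have "?m i j k - Poly_Mapping.single 1 1 = ?m (i - 1) j k"
    "?m i j k - Poly_Mapping.single 2 1 = ?m i (j - 1) k"
    "?m i j k - Poly_Mapping.single 3 1 = ?m i j (k - 1)"
    \<comment> \<open>Exponent vectors are subtracted pointwise with truncation, which agrees with
      \<open>i - 1\<close> even when the exponent is 0.\<close>
    by (rule poly_mapping_eqI; auto simp: lookup_add lookup_single lookup_minus when_def)+
  then show
    "mpol_deriv 1 (monom3 i j k c) = monom3 (i - 1) j k (of_nat i * c)"
    "mpol_deriv 2 (monom3 i j k c) = monom3 i (j - 1) k (of_nat j * c)"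
    "mpol_deriv 3 (monom3 i j k c) = monom3 i j (k - 1) (of_nat k * c)"
    by (simp_all add: monom3_def lookup_add lookup_single)
qed

lemma homogeneous_monom3: "i + j + k = d \<Longrightarrow> homogeneous d (monom3 i j k c)"
  unfolding monom3_def
  by (rule homogeneous_single) (simp add: sum_3 lookup_add lookup_single when_def)

lemma map_monom3 [simp]: "h 0 = 0 \<Longrightarrow> Poly_Mapping.map h (monom3 i j k c) = monom3 i j k (h c)"
  by (simp add: monom3_def map_single)

lemma Var_eq_monom3:
  "Var 1 = monom3 1 0 0 1" "Var 2 = monom3 0 1 0 1" "Var 3 = monom3 0 0 1 1"
  by (simp_all add: Var_def monom3_def)

lemma monom3_mult: "monom3 i j k c * monom3 i' j' k' c' = monom3 (i + i') (j + j') (k + k') (c * c')"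
  by (simp add: monom3_def mult_single single_add ac_simps)

lemma monom3_uminus: "- monom3 i j k c = monom3 i j k (- c)"
  by (simp add: monom3_def single_uminus)

text \<open>In this normal form evaluation, derivatives, homogeneity and change of field need only
  additivity and the case of one monomial; no product rule enters.\<close>

lemma curve_E_expand:
  "curve_E =
     monom3 0 0 3 (-1) + monom3 1 0 2 (-1) + monom3 0 1 2 (-1)
   + monom3 2 0 1 1 + monom3 1 1 1 1 + monom3 0 2 1 1
   + monom3 3 0 0 1 + monom3 2 1 0 1 + monom3 1 2 0 1 + monom3 0 3 0 1"
  by (simp add: curve_E_def q_def Var_eq_monom3 power2_eq_square power3_eq_cube distrib_left
      monom3_mult eval_nat_numeral flip: monom3_uminus)

lemma mpol_eval_curve_E: "mpol_eval curve_E x = q (x $ 1) (x $ 2) (x $ 3)"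
  by (simp add: curve_E_expand q_def algebra_simps)

text \<open>\<open>?A\<close>, \<open>?B\<close> and \<open>?C\<close> are the partial derivatives
  of \<open>q\<close> with respect to \<open>a\<close>, \<open>b\<close> and
  \<open>c\<close>.\<close>

lemma no_common_zero_partials_q:
  fixes a b c :: "'k::field_char_0"
  assumes qa: "- (c^2) + c * (2 * a + b) + 3 * a^2 + 2 * a * b + b^2 = 0" (is "?A = 0")
    and qb: "- (c^2) + c * (a + 2 * b) + a^2 + 2 * a * b + 3 * b^2 = 0" (is "?B = 0")
    and qc: "- 3 * c^2 - 2 * c * (a + b) + a^2 + a * b + b^2 = 0" (is "?C = 0")
  shows "a = 0 \<and> b = 0 \<and> c = 0"
proof -
  have "(a - b) * (c + 2 * (a + b)) = ?A - ?B"
    by (simp add: power2_eq_square algebra_simps)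
  then have "(a - b) * (c + 2 * (a + b)) = 0"
    unfolding qa qb by simp
  then have "a - b = 0 \<or> c + 2 * (a + b) = 0"
    by (simp only: mult_eq_0_iff)
  then consider "b = a" | "c = - (2 * (a + b))"
    by (metis eq_iff_diff_eq_0 eq_neg_iff_add_eq_0)
  then show ?thesis
  proof cases
    case 1
    \<comment> \<open>The factor 3 cancels \<open>c^2\<close>; every remaining term contains
      \<open>a\<close>.\<close>
    have "a * (13 * c + 15 * a) = 3 * ?A - ?C"
      unfolding 1 by (simp add: power2_eq_square algebra_simps)
    then have "a * (13 * c + 15 * a) = 0"
      unfolding qa qc by simp
    moreover have "a = 0" if "13 * c + 15 * a = 0"
    proof -
      \<comment> \<open>Division of \<open>169 * ?A\<close> by \<open>13 * c + 15 * a\<close>, as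
        polynomials in \<open>c\<close>, leaves the remainder \<open>204 * a^2\<close>.\<close>
      have "204 * a^2 = 169 * ?A + (13 * c + 15 * a) * (13 * c - 54 * a)"
        unfolding 1 by (simp add: power2_eq_square algebra_simps)
      then have "204 * a^2 = 0"
        unfolding qa that by simp
      then show ?thesis by simp
    qed
    ultimately have "a = 0" by auto
    then show ?thesis using qa 1 by simp
  next
    case 2
    \<comment> \<open>The factor 4 cancels the multiples of \<open>a^2 + a * b + b^2\<close>;
      substituting for \<open>c\<close> turns the rest into multiples of
      \<open>(a + b)^2\<close>.\<close>
    have "18 * (a + b)^2 = ?A + ?B - 4 * ?C"
      unfolding 2 by (simp add: power2_eq_square algebra_simps)
    then have "18 * (a + b)^2 = 0"
      unfolding qa qb qc by simp
    then have "b = - a"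
      by (simp add: eq_neg_iff_add_eq_0 add.commute)
    \<comment> \<open>Now \<open>c = 0\<close>, and \<open>qc\<close> reduces to
      \<open>a^2 = 0\<close>.\<close>
    then show ?thesis using qc 2 by (simp add: power2_eq_square)
  qed
qed

theorem proposition4p1:
  shows "elliptic_curve curve_E"
  unfolding elliptic_curve_def plane_cubic_def
proof (intro conjI)
  \<comment> \<open>The value at (1, 0, 0) is the coefficient of \<open>a^3\<close>.\<close>
  have "mpol_eval curve_E (axis 1 1) = 1"
    by (simp add: mpol_eval_curve_E q_def axis_def)
  then show "curve_E \<noteq> 0" by auto
  show "homogeneous 3 curve_E"
    unfolding curve_E_expand by (intro homogeneous_add homogeneous_monom3) simp_all
  show "smooth_hypersurface curve_E"
    unfolding smooth_hypersurface_def
  proof (rule equals0I)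
    fix P :: "(rat alg_closure ^ 3) set"
    let ?f = "Poly_Mapping.map to_ac curve_E :: (3, rat alg_closure) mpol"
    assume P: "P \<in> singular_points ?f"
    then obtain v where v: "P = proj_point v" "v \<noteq> 0"
      by (auto simp: singular_points_def proj_zeros_def proj_space_def)
    have "v \<in> P"
      unfolding v proj_point_def by (auto intro!: exI [of _ 1])
    with P have partials: "mpol_eval (mpol_deriv i ?f) v = 0" for i
      by (simp add: singular_points_def proj_zeros_def)
    have f: "?f =
       monom3 0 0 3 (-1) + monom3 1 0 2 (-1) + monom3 0 1 2 (-1)
     + monom3 2 0 1 1 + monom3 1 1 1 1 + monom3 0 2 1 1
     + monom3 3 0 0 1 + monom3 2 1 0 1 + monom3 1 2 0 1 + monom3 0 3 0 1"
      \<comment> \<open>\<open>to_ac\<close> is a ring homomorphism, so the coefficients 1 and -1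
        are preserved.\<close>
      by (simp add: curve_E_expand map_add_poly_mapping)
    have "v $ 1 = 0 \<and> v $ 2 = 0 \<and> v $ 3 = 0"
      using partials [of 1] partials [of 2] partials [of 3]
      by (intro no_common_zero_partials_q) (simp_all add: f algebra_simps)
    then have "v = 0" by (simp add: vec_eq_iff forall_3)
    with v show False by simp
  qed
  \<comment> \<open>For \<open>c = 0\<close> the form is \<open>(a + b) * (a^2 + b^2)\<close>, which
    vanishes at all multiples of (1, -1, 0).\<close>
  have "(vector [1, -1, 0] :: rat ^ 3) \<noteq> 0"
    by (simp add: vec_eq_iff forall_3)
  then have "proj_point (vector [1, -1, 0]) \<in> proj_zeros curve_E"
    by (auto simp: proj_zeros_def proj_space_def proj_point_def mpol_eval_curve_E q_def
        power2_eq_square power3_eq_cube)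
  then show "proj_zeros curve_E \<noteq> {}" by auto
qed

end
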